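(* Let $\{(x^k,z^k,y^k)\}_{k\in\mathbb N}$ be a sequence generated by FLAG (described in the context). Suppose that $\sigma>0$ and $0\preceq P\preceq(\sigma/2)I_n$. Then, for any optimal solution $x^*$ of problem (P) and every integer $N\ge 1$, $$\Psi(x^N)-\Psi(x^* )\le\frac{B_{\rho,c}(x^* )}{2N^2},\qquad \|\mathcal A x^N-b\|\le\frac{B_{\rho,c}(x^* )}{cN^2},$$ where $B_{\rho,c}(x^* ):=4\left(\|x^*-z^0\|_P^2+\frac{1}{\mu\rho}(\|y^0\|+c)^2\right)$.
   Context: **Problem.** Let $\Psi:\mathbb R^n\to(-\infty,+\infty]$ be proper, lower semicontinuous and $\sigma$-strongly convex with $\sigma\ge 0$ ($\sigma=0$ means merely convex), $\mathcal A:\mathbb R^n\to\mathbb R^m$ linear, $b\in\mathbb R^m$. Problem (P) is $\min\{\Psi(x):\mathcal A x=b,\ x\in\mathbb R^n\}$, with feasible set $\mathcal F=\{x\in\mathbb R^n:\mathcal A x=b\}$. The Lagrangian is $\mathcal L(x,y)=\Psi(x)+\langle y,\mathcal A x-b\rangle$ and, for $\rho\geq 0$, the augmented Lagrangian is $\mathcal L_\rho(x,y)=\mathcal L(x,y)+\frac{\rho}{2}\|\mathcal A x-b\|^2$. Standing assumption: $\mathcal L$ has a saddle point, i.e. there is $(x^*,y^* )$ with $\mathcal L(x^*,y)\le\mathcal L(x^*,y^* )\le\mathcal L(x,y^* )$ for all $x\in\mathbb R^n,y\in\mathbb R^m$. The dual problem is to maximize $\inf_x\mathcal L(x,y)$ over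 $y\in\mathbb R^m$. The constant $c>0$ is such that $c\ge 2\|y^*\|$, where $y^*$ is an optimal solution of the dual problem. **Notation.** $\mathbb S_+^n$ is the set of $n\times n$ symmetric positive semidefinite matrices; for $P\in\mathbb S_+^n$, $\|u\|_P=\sqrt{\langle u,Pu\rangle}$ and $\Delta_P(u,v,w)=\frac12(\|u-v\|_P^2-\|u-w\|_P^2)$. **Nice primal algorithmic map.** Given $\rho,t>0$, let $\rho_t=\rho,\tau_t=1$ if $\sigma=0$, and $\rho_t=\rho t,\tau_t=t$ if $\sigma>0$. A (possibly set-valued) map $\mathrm{Prim}_t$ on $\mathbb R^n\times\mathbb R^m$ with values in $\mathbb R^n$ is nice with $\delta\in(0,1]$ and $P,Q\in\mathbb S_+^n$ if for all $(z,\lambda)$, all $z^+\in\mathrm{Prim}_t(z,\lambda)$ and all $\xi\in\mathcal F$, $$\mathcal L_{\rho_t}(z^+,\lambda)-\mathcal L_{\rho_t}(\xi,\lambda)\le\tau_t\Delta_P(\xi,z,z^+)-\frac{\tau_t}{2}\|z^+-z\|_Q^2-\frac{\sigma}{2}\|\xi-z^+\|^2-\frac{\delta\rho_t}{2}\|\mathcal A z^+-b\|^2.$$ **FLAG.** Put $p=1$ if $\sigma=0$ and $p=2$ if $\sigma>0$. Input: maps $\mathrm{Prim}_{t_k}$ that are nice with the same $\delta,P,Q$ for all $k$. Choose $\mu\in(0,\delta]$, $\rho>0$, any $(x^0,z^0,y^0)\in\mathbb R^n\times\mathbb R^n\times\mathbb R^m$, $t_0=1$. For $k\ge0$ let $\rho_k=\rho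 t_k^{p-1}$ (so $\rho_k=\rho$ if $\sigma=0$, $\rho_k=\rho t_k$ if $\sigma>0$) and $$\lambda^k=y^k+\rho_k(t_k-1)(\mathcal A x^k-b),\quad z^{k+1}\in\mathrm{Prim}_{t_k}(z^k,\lambda^k),\quad y^{k+1}=y^k+\mu\rho_k(\mathcal A z^{k+1}-b),\quad x^{k+1}=(1-t_k^{-1})x^k+t_k^{-1}z^{k+1},$$ and $t_{k+1}=t_k+1$ if $p=1$, $t_{k+1}=(1+\sqrt{1+4t_k^2})/2$ if $p=2$. *)

theory Defs
  imports "HOL-Analysis.Analysis"
begin

definition proper :: "(real^'n \<Rightarrow> ereal) \<Rightarrow> bool" where
  "proper \<Psi> \<longleftrightarrow> (\<forall>x. \<Psi> x \<noteq> -\<infinity>) \<and> (\<exists>x. \<Psi> x \<noteq> \<infinity>)"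

definition lower_semicontinuous :: "(real^'n \<Rightarrow> ereal) \<Rightarrow> bool" where
  "lower_semicontinuous \<Psi> \<longleftrightarrow> (\<forall>x. \<Psi> x \<le> Liminf (at x) \<Psi>)"

definition strongly_convex :: "real \<Rightarrow> (real^'n \<Rightarrow> ereal) \<Rightarrow> bool" where
  "strongly_convex \<sigma> \<Psi> \<longleftrightarrow>
     (\<forall>u v s. 0 < s \<and> s < 1 \<longrightarrow>
        \<Psi> (s *\<^sub>R u + (1 - s) *\<^sub>R v)
          \<le> ereal s * \<Psi> u + ereal (1 - s) * \<Psi> v - ereal (\<sigma> / 2 * s * (1 - s) * (norm (u - v))\<^sup>2))"

definition psd :: "real^'n^'n \<Rightarrow> bool" where
  "psd P \<longleftrightarrow> transpose P = P \<and> (\<forall>u. 0 \<le> u \<bullet> (P *v u))"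

definition loewner_le :: "real^'n^'n \<Rightarrow> real^'n^'n \<Rightarrow> bool" where
  "loewner_le P R \<longleftrightarrow> psd (R - P)"

definition norm_wrt :: "real^'n^'n \<Rightarrow> real^'n \<Rightarrow> real" where
  "norm_wrt P u = sqrt (u \<bullet> (P *v u))"

definition Delta_wrt :: "real^'n^'n \<Rightarrow> real^'n \<Rightarrow> real^'n \<Rightarrow> real^'n \<Rightarrow> real" where
  "Delta_wrt P u v w = 1 / 2 * ((norm_wrt P (u - v))\<^sup>2 - (norm_wrt P (u - w))\<^sup>2)"

definition feasible_set :: "(real^'n \<Rightarrow> real^'m) \<Rightarrow> real^'m \<Rightarrow> (real^'n) set" where
  "feasible_set A b = {x. A x = b}"

definition primal_optimal ::
  "(real^'n \<Rightarrow> ereal) \<Rightarrow> (real^'n \<Rightarrow> real^'m) \<Rightarrow> real^'m \<Rightarrow> real^'n \<Rightarrow> bool" where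
  "primal_optimal \<Psi> A b xs \<longleftrightarrow>
     xs \<in> feasible_set A b \<and> (\<forall>x \<in> feasible_set A b. \<Psi> xs \<le> \<Psi> x)"

definition lagrangian ::
  "(real^'n \<Rightarrow> ereal) \<Rightarrow> (real^'n \<Rightarrow> real^'m) \<Rightarrow> real^'m \<Rightarrow> real^'n \<Rightarrow> real^'m \<Rightarrow> ereal" where
  "lagrangian \<Psi> A b x y = \<Psi> x + ereal (y \<bullet> (A x - b))"

definition aug_lagrangian ::
  "(real^'n \<Rightarrow> ereal) \<Rightarrow> (real^'n \<Rightarrow> real^'m) \<Rightarrow> real^'m \<Rightarrow> real \<Rightarrow> real^'n \<Rightarrow> real^'m \<Rightarrow> ereal" where
  "aug_lagrangian \<Psi> A b \<rho> x y = lagrangian \<Psi> A b x y + ereal (\<rho> / 2 * (norm (A x - b))\<^sup>2)"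

definition saddle_point ::
  "(real^'n \<Rightarrow> ereal) \<Rightarrow> (real^'n \<Rightarrow> real^'m) \<Rightarrow> real^'m \<Rightarrow> real^'n \<Rightarrow> real^'m \<Rightarrow> bool" where
  "saddle_point \<Psi> A b xs ys \<longleftrightarrow>
     (\<forall>x y. lagrangian \<Psi> A b xs y \<le> lagrangian \<Psi> A b xs ys \<and>
            lagrangian \<Psi> A b xs ys \<le> lagrangian \<Psi> A b x ys)"

definition dual_function ::
  "(real^'n \<Rightarrow> ereal) \<Rightarrow> (real^'n \<Rightarrow> real^'m) \<Rightarrow> real^'m \<Rightarrow> real^'m \<Rightarrow> ereal" where
  "dual_function \<Psi> A b y = (INF x. lagrangian \<Psi> A b x y)"

definition dual_optimal ::
  "(real^'n \<Rightarrow> ereal) \<Rightarrow> (real^'n \<Rightarrow> real^'m) \<Rightarrow> real^'m \<Rightarrow> real^'m \<Rightarrow> bool" where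
  "dual_optimal \<Psi> A b ys \<longleftrightarrow> (\<forall>y. dual_function \<Psi> A b y \<le> dual_function \<Psi> A b ys)"

definition penalty :: "real \<Rightarrow> real \<Rightarrow> real \<Rightarrow> real" where
  "penalty \<sigma> \<rho> t = (if \<sigma> = 0 then \<rho> else \<rho> * t)"

definition prox_weight :: "real \<Rightarrow> real \<Rightarrow> real" where
  "prox_weight \<sigma> t = (if \<sigma> = 0 then 1 else t)"

text \<open>The difference of augmented Lagrangians below is taken in \<^typ>\<open>ereal\<close>, where
  \<open>\<infinity> - \<infinity> = \<infinity>\<close>. As soon as some feasible point has a finite value of a proper \<open>\<Psi>\<close>,
  the inequality at that point already forces \<open>\<Psi> z'\<close> to be finite, and the inequality then
  holds trivially at feasible points \<open>\<xi>\<close> with \<open>\<Psi> \<xi> = \<infinity>\<close>.\<close>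

definition nice_primal_map ::
  "(real^'n \<Rightarrow> ereal) \<Rightarrow> (real^'n \<Rightarrow> real^'m) \<Rightarrow> real^'m \<Rightarrow> real \<Rightarrow> real \<Rightarrow> real \<Rightarrow>
   real \<Rightarrow> real^'n^'n \<Rightarrow> real^'n^'n \<Rightarrow> ((real^'n) \<times> (real^'m) \<Rightarrow> (real^'n) set) \<Rightarrow> bool" where
  "nice_primal_map \<Psi> A b \<sigma> \<rho> t \<delta> P Q Prim \<longleftrightarrow>
     0 < \<delta> \<and> \<delta> \<le> 1 \<and> psd P \<and> psd Q \<and>
     (\<forall>z lam. \<forall>z' \<in> Prim (z, lam). \<forall>\<xi> \<in> feasible_set A b.
        aug_lagrangian \<Psi> A b (penalty \<sigma> \<rho> t) z' lam - aug_lagrangian \<Psi> A b (penalty \<sigma> \<rho> t) \<xi> lam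
          \<le> ereal (prox_weight \<sigma> t * Delta_wrt P \<xi> z z'
                   - prox_weight \<sigma> t / 2 * (norm_wrt Q (z' - z))\<^sup>2
                   - \<sigma> / 2 * (norm (\<xi> - z'))\<^sup>2
                   - \<delta> * penalty \<sigma> \<rho> t / 2 * (norm (A z' - b))\<^sup>2))"

text \<open>The cases \<open>p = 1\<close> and \<open>p = 2\<close> are \<open>\<sigma> = 0\<close> and \<open>\<sigma> > 0\<close>, so that
  \<open>\<rho> * t\<^sub>k ^ (p - 1)\<close> is \<open>penalty \<sigma> \<rho> t\<^sub>k\<close>.\<close>

primrec flag_t :: "real \<Rightarrow> nat \<Rightarrow> real" where
  "flag_t \<sigma> 0 = 1"
| "flag_t \<sigma> (Suc k) =
     (if \<sigma> = 0 then flag_t \<sigma> k + 1 else (1 + sqrt (1 + 4 * (flag_t \<sigma> k)\<^sup>2)) / 2)"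

definition flag_sequence ::
  "(real^'n \<Rightarrow> real^'m) \<Rightarrow> real^'m \<Rightarrow> real \<Rightarrow> real \<Rightarrow> real \<Rightarrow>
   (real \<Rightarrow> (real^'n) \<times> (real^'m) \<Rightarrow> (real^'n) set) \<Rightarrow>
   (nat \<Rightarrow> real^'n) \<Rightarrow> (nat \<Rightarrow> real^'n) \<Rightarrow> (nat \<Rightarrow> real^'m) \<Rightarrow> bool" where
  "flag_sequence A b \<sigma> \<rho> \<mu> Prim x z y \<longleftrightarrow>
     (\<forall>k. let t = flag_t \<sigma> k;
              \<rho>k = penalty \<sigma> \<rho> t;
              lam = y k + (\<rho>k * (t - 1)) *\<^sub>R (A (x k) - b)
          in z (Suc k) \<in> Prim t (z k, lam) \<and>
             y (Suc k) = y k + (\<mu> * \<rho>k) *\<^sub>R (A (z (Suc k)) - b) \<and>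
             x (Suc k) = (1 - 1 / t) *\<^sub>R x k + (1 / t) *\<^sub>R z (Suc k))"

definition B_const ::
  "real^'n^'n \<Rightarrow> real \<Rightarrow> real \<Rightarrow> real \<Rightarrow> real^'n \<Rightarrow> real^'m \<Rightarrow> real^'n \<Rightarrow> real" where
  "B_const P \<mu> \<rho> c z0 y0 xs =
     4 * ((norm_wrt P (xs - z0))\<^sup>2 + 1 / (\<mu> * \<rho>) * (norm y0 + c)\<^sup>2)"

end

theory Submission
  imports Defs
begin

text \<open>
  Fix a multiplier \<open>\<eta>\<close> and a solution \<open>x\<^sup>*\<close>, and write \<open>r\<^sub>k = A x\<^sub>k - b\<close>. The proof
  is a Lyapunov argument: for \<open>T\<^sub>k = t\<^sub>k\<^sup>2 - t\<^sub>k\<close> the energy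

  \<open>T\<^sub>k (\<Psi> x\<^sub>k - \<Psi> x\<^sup>* + \<eta> \<bullet> r\<^sub>k) + (\<rho>/2) T\<^sub>k\<^sup>2 \<parallel>r\<^sub>k\<parallel>\<^sup>2 + (t\<^sub>k\<^sup>2/2) \<parallel>x\<^sup>* - z\<^sub>k\<parallel>\<^sub>P\<^sup>2 + \<parallel>y\<^sub>k - \<eta>\<parallel>\<^sup>2 / (2 \<mu> \<rho>)\<close>

  does not increase along the iteration (\<open>flag_energy_step\<close>). Each of the four summands
  uses one ingredient of the method:

  \<^item> The recursion for \<open>t\<close> says \<open>T\<^bsub>k+1\<^esub> = t\<^sub>k\<^sup>2\<close>. As \<open>t\<^sub>k x\<^bsub>k+1\<^esub> = (t\<^sub>k - 1) x\<^sub>k + z\<^bsub>k+1\<^esub>\<close>,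
    convexity of \<open>\<Psi>\<close> bounds \<open>t\<^sub>k \<cdot> (\<Psi> z\<^bsub>k+1\<^esub> - \<Psi> x\<^sup>*)\<close> from below by the increment of
    \<open>T\<^sub>k (\<Psi> x\<^sub>k - \<Psi> x\<^sup>*)\<close>, and the linear term in \<open>\<eta>\<close> telescopes exactly.
  \<^item> The extrapolated multiplier \<open>\<lambda>\<^sub>k\<close> is chosen so that its extra term completes a
    square with the penalty, which makes the squared residuals telescope.
  \<^item> The primal proximal terms carry the weight \<open>t\<^sub>k\<^sup>2\<close>, which grows. Its growth
    \<open>t\<^bsub>k+1\<^esub>\<^sup>2 - t\<^sub>k\<^sup>2 = t\<^bsub>k+1\<^esub> \<le> 2 t\<^sub>k\<close> is paid for by the strong convexity term; this
    is where \<open>P \<preceq> (\<sigma>/2) I\<close> enters.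
  \<^item> The dual update is an ascent step, so the cross term with \<open>y\<^sub>k - \<eta>\<close> telescopes up to
    \<open>\<parallel>y\<^bsub>k+1\<^esub> - y\<^sub>k\<parallel>\<^sup>2\<close>, which the surplus \<open>\<delta> \<ge> \<mu>\<close> of the primal map absorbs.

  At \<open>k = 0\<close> the energy has no contribution from \<open>x\<^sub>0\<close> because \<open>t\<^sub>0 = 1\<close>, so telescoping
  (\<open>flag_lagrangian_gap\<close>) bounds \<open>t\<^bsub>N-1\<^esub>\<^sup>2 (\<Psi> x\<^sub>N - \<Psi> x\<^sup>* + \<eta> \<bullet> r\<^sub>N)\<close> by the initial
  distances. Taking \<open>\<eta>\<close> of norm at most \<open>c\<close> in the direction of \<open>r\<^sub>N\<close>, and using
  \<open>t\<^bsub>N-1\<^esub> \<ge> N/2\<close>, gives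
  \<open>\<Psi> x\<^sub>N - \<Psi> x\<^sup>* + c \<parallel>r\<^sub>N\<parallel> \<le> B / (8 t\<^bsub>N-1\<^esub>\<^sup>2) \<le> B / (2 N\<^sup>2)\<close>. The objective bound is
  immediate. The residual bound follows because the optimal multiplier \<open>y\<^sup>*\<close> is an exact penalty
  (\<open>dual_optimal_lower_bound\<close>): \<open>\<Psi> x\<^sub>N - \<Psi> x\<^sup>* \<ge> - \<parallel>y\<^sup>*\<parallel> \<parallel>r\<^sub>N\<parallel> \<ge> - (c/2) \<parallel>r\<^sub>N\<parallel>\<close>.
\<close>

section \<open>The step parameters\<close>

lemma flag_t_ge:
  assumes "\<sigma> \<noteq> 0"
  shows "(real k + 2) / 2 \<le> flag_t \<sigma> k"
proof (induction k)
  case (Suc k)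
  have "2 * flag_t \<sigma> k \<le> sqrt (1 + 4 * (flag_t \<sigma> k)\<^sup>2)"
    by (rule real_le_rsqrt) (simp add: power_mult_distrib)
  then show ?case
    using Suc assms by simp
qed simp

lemma flag_t_ge_1:
  assumes "\<sigma> \<noteq> 0"
  shows "1 \<le> flag_t \<sigma> k"
  using order_trans[OF _ flag_t_ge[OF assms, of k], of 1] by simp

text \<open>This identity is what makes the method telescope. After weighting by \<open>t\<^sub>k\<close>, the averaging
  step contributes \<open>x\<^bsub>k+1\<^esub>\<close> with coefficient \<open>t\<^sub>k\<^sup>2\<close> and \<open>x\<^sub>k\<close> with coefficient
  \<open>t\<^sub>k\<^sup>2 - t\<^sub>k\<close>; the two match across consecutive iterations.\<close>

lemma flag_t_Suc_square:
  assumes "\<sigma> \<noteq> 0"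
  shows "(flag_t \<sigma> (Suc k))\<^sup>2 - flag_t \<sigma> (Suc k) = (flag_t \<sigma> k)\<^sup>2"
proof -
  define q where "q = sqrt (1 + 4 * (flag_t \<sigma> k)\<^sup>2)"
  have q2: "q\<^sup>2 = 1 + 4 * (flag_t \<sigma> k)\<^sup>2"
    unfolding q_def by simp
  have u: "flag_t \<sigma> (Suc k) = (1 + q) / 2"
    using assms by (simp add: q_def)
  have "(flag_t \<sigma> (Suc k))\<^sup>2 - flag_t \<sigma> (Suc k) = (q\<^sup>2 - 1) / 4"
    unfolding u by (simp add: power2_eq_square field_simps)
  then show ?thesis
    using q2 by simp
qed

lemma flag_t_Suc_le:
  assumes "\<sigma> \<noteq> 0"
  shows "flag_t \<sigma> (Suc k) \<le> 2 * flag_t \<sigma> k"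
proof (rule ccontr)
  let ?t = "flag_t \<sigma> k" and ?u = "flag_t \<sigma> (Suc k)"
  assume "\<not> ?u \<le> 2 * ?t"
  then have "2 * ?t < ?u" "2 * ?t - 1 < ?u - 1" by linarith+
  then have "(2 * ?t) * (2 * ?t - 1) < ?u * (?u - 1)"
    using flag_t_ge_1[OF assms, of k] by (intro mult_strict_mono) linarith+
  moreover have "?u * (?u - 1) = ?t * ?t"
    using flag_t_Suc_square[OF assms, of k] by (simp add: power2_eq_square algebra_simps)
  moreover have "?t * 1 \<le> ?t * ?t"
    using flag_t_ge_1[OF assms, of k] by (intro mult_left_mono) linarith+
  ultimately show False
    using flag_t_ge_1[OF assms, of k] by (simp add: algebra_simps)
qed

section \<open>The weighted seminorm\<close>

lemma norm_wrt_square: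
  assumes "loewner_le 0 P"
  shows "(norm_wrt P u)\<^sup>2 = u \<bullet> (P *v u)"
  using assms by (simp add: loewner_le_def psd_def norm_wrt_def)

lemma norm_wrt_square_le:
  assumes "loewner_le 0 P" "loewner_le P (s *\<^sub>R mat 1)"
  shows "(norm_wrt P u)\<^sup>2 \<le> s * (norm u)\<^sup>2"
proof -
  have "0 \<le> u \<bullet> ((s *\<^sub>R mat 1 - P) *v u)"
    using assms(2) by (simp add: loewner_le_def psd_def)
  also have "\<dots> = s * (norm u)\<^sup>2 - u \<bullet> (P *v u)"
    by (simp add: matrix_vector_mult_diff_rdistrib inner_diff_right
        scaleR_matrix_vector_assoc[symmetric] power2_norm_eq_inner)
  finally show ?thesis
    using norm_wrt_square[OF assms(1)] by simp
qed

section \<open>Optimal multipliers are exact penalties\<close>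

lemma saddle_point_finite:
  assumes "proper \<Psi>" "saddle_point \<Psi> A b xs ys"
  obtains p where "\<Psi> xs = ereal p"
proof -
  obtain u where u: "\<Psi> u \<noteq> \<infinity>"
    using assms(1) by (auto simp: proper_def)
  have "lagrangian \<Psi> A b xs ys \<le> lagrangian \<Psi> A b u ys"
    using assms(2) by (auto simp: saddle_point_def)
  then have "\<Psi> xs \<noteq> \<infinity>"
    using u by (cases "\<Psi> u") (auto simp: lagrangian_def)
  moreover have "\<Psi> xs \<noteq> -\<infinity>"
    using assms(1) by (auto simp: proper_def)
  ultimately show ?thesis
    using that by (cases "\<Psi> xs") auto
qed

lemma saddle_point_feasible:
  assumes "proper \<Psi>" "saddle_point \<Psi> A b xs ys"
  shows "A xs = b"
proof -
  obtain p where p: "\<Psi> xs = ereal p"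
    using saddle_point_finite[OF assms] .
  have "lagrangian \<Psi> A b xs (ys + (A xs - b)) \<le> lagrangian \<Psi> A b xs ys"
    using assms(2) by (auto simp: saddle_point_def)
  then have "(A xs - b) \<bullet> (A xs - b) \<le> 0"
    by (simp add: p lagrangian_def inner_add_left)
  then show ?thesis
    by (metis inner_eq_zero_iff inner_ge_zero order_antisym right_minus_eq)
qed

text \<open>By strong duality, which the saddle point provides, the maximal dual value is the primal
  optimal value. Hence an optimal multiplier bounds the Lagrangian from below by that value,
  although it need not be the multiplier of the given saddle point.\<close>

lemma dual_optimal_lower_bound:
  assumes psi_proper: "proper \<Psi>" and sad: "saddle_point \<Psi> A b xs ys"
    and dual: "dual_optimal \<Psi> A b ystar" and opt: "primal_optimal \<Psi> A b xstar"
  shows "\<Psi> xstar \<le> \<Psi> u + ereal (ystar \<bullet> (A u - b))"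
proof -
  have feas: "A xs = b"
    by (rule saddle_point_feasible[OF psi_proper sad])
  have "\<Psi> xstar \<le> \<Psi> xs"
    using opt feas by (auto simp: primal_optimal_def feasible_set_def)
  also have "\<Psi> xs = lagrangian \<Psi> A b xs ys"
    by (simp add: lagrangian_def feas flip: zero_ereal_def)
  also have "\<dots> \<le> dual_function \<Psi> A b ys"
    unfolding dual_function_def using sad by (intro INF_greatest) (auto simp: saddle_point_def)
  also have "\<dots> \<le> dual_function \<Psi> A b ystar"
    using dual by (auto simp: dual_optimal_def)
  also have "\<dots> \<le> lagrangian \<Psi> A b u ystar"
    unfolding dual_function_def by (rule INF_lower) simp
  finally show ?thesis
    by (simp add: lagrangian_def)
qed

lemma primal_optimal_finite:
  assumes "proper \<Psi>" "saddle_point \<Psi> A b xs ys" "primal_optimal \<Psi> A b xstar"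
  obtains p where "\<Psi> xstar = ereal p"
proof -
  obtain q where "\<Psi> xs = ereal q"
    using saddle_point_finite[OF assms(1,2)] .
  moreover have "\<Psi> xstar \<le> \<Psi> xs"
    using assms(3) saddle_point_feasible[OF assms(1,2)]
    by (auto simp: primal_optimal_def feasible_set_def)
  moreover have "\<Psi> xstar \<noteq> -\<infinity>"
    using assms(1) by (auto simp: proper_def)
  ultimately show ?thesis
    using that by (cases "\<Psi> xstar") auto
qed

section \<open>The two analytic inputs in real form\<close>

text \<open>At a feasible point of finite value the extended real inequality of a nice map is an
  ordinary one. In particular every output of the map lies in the domain of \<open>\<Psi>\<close>, so the
  iteration stays there even if its starting point does not.\<close>

lemma nice_primal_map_real:
  assumes "proper \<Psi>" and nice: "nice_primal_map \<Psi> A b \<sigma> \<rho> t \<delta> P Q Prim"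
    and "z' \<in> Prim (z, lam)" and "A \<xi> = b" and p: "\<Psi> \<xi> = ereal p"
    and "\<sigma> > 0" and "t \<ge> 0"
  obtains q where "\<Psi> z' = ereal q"
    and "q - p + lam \<bullet> (A z' - b) + \<rho> * t / 2 * (norm (A z' - b))\<^sup>2
      \<le> t / 2 * ((norm_wrt P (\<xi> - z))\<^sup>2 - (norm_wrt P (\<xi> - z'))\<^sup>2)
        - \<sigma> / 2 * (norm (\<xi> - z'))\<^sup>2 - \<delta> * (\<rho> * t) / 2 * (norm (A z' - b))\<^sup>2"
proof -
  let ?R = "t * Delta_wrt P \<xi> z z' - t / 2 * (norm_wrt Q (z' - z))\<^sup>2
      - \<sigma> / 2 * (norm (\<xi> - z'))\<^sup>2 - \<delta> * (\<rho> * t) / 2 * (norm (A z' - b))\<^sup>2"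
  have "\<xi> \<in> feasible_set A b"
    using assms by (simp add: feasible_set_def)
  then have "aug_lagrangian \<Psi> A b (penalty \<sigma> \<rho> t) z' lam
      - aug_lagrangian \<Psi> A b (penalty \<sigma> \<rho> t) \<xi> lam
    \<le> ereal (prox_weight \<sigma> t * Delta_wrt P \<xi> z z'
        - prox_weight \<sigma> t / 2 * (norm_wrt Q (z' - z))\<^sup>2 - \<sigma> / 2 * (norm (\<xi> - z'))\<^sup>2
        - \<delta> * penalty \<sigma> \<rho> t / 2 * (norm (A z' - b))\<^sup>2)"
    using nice assms(3) unfolding nice_primal_map_def by blast
  then have "aug_lagrangian \<Psi> A b (\<rho> * t) z' lam - aug_lagrangian \<Psi> A b (\<rho> * t) \<xi> lam
      \<le> ereal ?R"
    using \<open>\<sigma> > 0\<close> by (simp add: penalty_def prox_weight_def)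
  then have le: "\<Psi> z' + ereal (lam \<bullet> (A z' - b)) + ereal (\<rho> * t / 2 * (norm (A z' - b))\<^sup>2)
      - ereal p \<le> ereal ?R"
    using assms(4) by (simp add: aug_lagrangian_def lagrangian_def p)
  moreover have "\<Psi> z' \<noteq> -\<infinity>"
    using assms(1) by (auto simp: proper_def)
  ultimately obtain q where q: "\<Psi> z' = ereal q"
    by (cases "\<Psi> z'") auto
  moreover have "0 \<le> t / 2 * (norm_wrt Q (z' - z))\<^sup>2"
    using \<open>t \<ge> 0\<close> by simp
  moreover have "t * Delta_wrt P \<xi> z z'
      = t / 2 * ((norm_wrt P (\<xi> - z))\<^sup>2 - (norm_wrt P (\<xi> - z'))\<^sup>2)"
    by (simp add: Delta_wrt_def)
  moreover have "q + lam \<bullet> (A z' - b) + \<rho> * t / 2 * (norm (A z' - b))\<^sup>2 - p \<le> ?R"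
    using le by (simp add: q)
  ultimately show ?thesis
    by (intro that[of q]) linarith+
qed

text \<open>The case \<open>t = 1\<close> discards the point \<open>u\<close>, whose value may then be infinite. That case is
  the first iteration.\<close>

lemma strongly_convex_average:
  assumes "proper \<Psi>" "strongly_convex \<sigma> \<Psi>" "\<sigma> \<ge> 0" "t \<ge> 1" and q: "\<Psi> v = ereal q"
    and fin: "t = 1 \<or> \<Psi> u = ereal p"
  obtains w where "\<Psi> ((1 - 1 / t) *\<^sub>R u + (1 / t) *\<^sub>R v) = ereal w"
    and "t * w \<le> (t - 1) * p + q"
proof (cases "t = 1")
  case True
  then show ?thesis
    using that[of q] q by simp
next
  case False
  let ?w = "(1 - 1 / t) *\<^sub>R u + (1 / t) *\<^sub>R v"
  have s: "0 < 1 - 1 / t" "1 - 1 / t < 1"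
    using False \<open>t \<ge> 1\<close> by (auto simp: field_simps)
  have u: "\<Psi> u = ereal p"
    using False fin by simp
  let ?d = "\<sigma> / 2 * (1 - 1 / t) * (1 - (1 - 1 / t)) * (norm (u - v))\<^sup>2"
  have "\<Psi> ((1 - 1 / t) *\<^sub>R u + (1 - (1 - 1 / t)) *\<^sub>R v)
      \<le> ereal (1 - 1 / t) * \<Psi> u + ereal (1 - (1 - 1 / t)) * \<Psi> v - ereal ?d"
    using assms(2) s unfolding strongly_convex_def by blast
  then have le: "\<Psi> ?w \<le> ereal ((1 - 1 / t) * p + 1 / t * q - ?d)"
    by (simp add: u q)
  moreover have "\<Psi> ?w \<noteq> -\<infinity>"
    using assms(1) by (auto simp: proper_def)
  ultimately obtain w where w: "\<Psi> ?w = ereal w"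
    by (cases "\<Psi> ?w") auto
  have "0 \<le> ?d"
    using \<open>\<sigma> \<ge> 0\<close> s by simp
  with le w have "w \<le> (1 - 1 / t) * p + 1 / t * q"
    by simp
  then have "t * w \<le> t * ((1 - 1 / t) * p + 1 / t * q)"
    using \<open>t \<ge> 1\<close> by (intro mult_left_mono) auto
  also have "\<dots> = (t - 1) * p + q"
    using \<open>t \<ge> 1\<close> by (simp add: field_simps)
  finally show ?thesis
    using that[OF w] by blast
qed

section \<open>Decrease of the energy\<close>

text \<open>The dual part of one iteration. Expanding \<open>\<parallel>t r'\<parallel>\<^sup>2\<close> shows that the extrapolation term
  \<open>\<rho> t (t - 1) r\<close> of the multiplier supplies the cross term \<open>r \<bullet> s\<close>, and expanding
  \<open>\<parallel>y' - \<eta>\<parallel>\<^sup>2\<close> turns the rest of the multiplier term into a difference of squared distances.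
  These are identities; the inequality only replaces the second-order dual term
  \<open>\<mu> \<rho> t\<^sup>2 \<parallel>s\<parallel>\<^sup>2 / 2\<close> by the larger surplus with \<open>\<delta>\<close>.\<close>

lemma dual_energy_increment:
  fixes r r' s y y' \<eta> :: "'a::real_inner"
  assumes r': "t *\<^sub>R r' = (t - 1) *\<^sub>R r + s"
    and y': "y' = y + (\<mu> * (\<rho> * t)) *\<^sub>R s"
    and "0 < \<mu>" "\<mu> \<le> \<delta>" "0 < \<rho>"
  shows "t\<^sup>2 * (\<eta> \<bullet> r') + \<rho> / 2 * (t\<^sup>2)\<^sup>2 * (norm r')\<^sup>2 + 1 / (2 * \<mu> * \<rho>) * (norm (y' - \<eta>))\<^sup>2
      - ((t\<^sup>2 - t) * (\<eta> \<bullet> r) + \<rho> / 2 * (t\<^sup>2 - t)\<^sup>2 * (norm r)\<^sup>2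
         + 1 / (2 * \<mu> * \<rho>) * (norm (y - \<eta>))\<^sup>2)
    \<le> t * ((y + (\<rho> * t * (t - 1)) *\<^sub>R r) \<bullet> s + \<rho> * t / 2 * (norm s)\<^sup>2
           + \<delta> * (\<rho> * t) / 2 * (norm s)\<^sup>2)"
proof -
  have lin: "t\<^sup>2 * (\<eta> \<bullet> r') - (t\<^sup>2 - t) * (\<eta> \<bullet> r) = t * (\<eta> \<bullet> s)"
  proof -
    have "t * (\<eta> \<bullet> r') = (t - 1) * (\<eta> \<bullet> r) + \<eta> \<bullet> s"
      using arg_cong[OF r', of "\<lambda>v. \<eta> \<bullet> v"] by (simp add: inner_add_right)
    then have "t * (t * (\<eta> \<bullet> r')) = t * ((t - 1) * (\<eta> \<bullet> r) + \<eta> \<bullet> s)"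
      by simp
    then show ?thesis
      by (simp add: power2_eq_square algebra_simps)
  qed
  have pen: "\<rho> / 2 * (t\<^sup>2)\<^sup>2 * (norm r')\<^sup>2 - \<rho> / 2 * (t\<^sup>2 - t)\<^sup>2 * (norm r)\<^sup>2
      = t * (\<rho> * t * (t - 1) * (r \<bullet> s) + \<rho> * t / 2 * (norm s)\<^sup>2)"
  proof -
    have "t\<^sup>2 * (norm r')\<^sup>2 = (norm (t *\<^sub>R r'))\<^sup>2"
      by (simp add: power_mult_distrib)
    also have "\<dots> = (t - 1)\<^sup>2 * (norm r)\<^sup>2 + 2 * (t - 1) * (r \<bullet> s) + (norm s)\<^sup>2"
      unfolding r' by (simp only: power2_norm_eq_inner)
        (simp add: inner_add_left inner_add_right inner_commute power2_eq_square algebra_simps)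
    finally have "\<rho> / 2 * t\<^sup>2 * (t\<^sup>2 * (norm r')\<^sup>2)
        = \<rho> / 2 * t\<^sup>2 * ((t - 1)\<^sup>2 * (norm r)\<^sup>2 + 2 * (t - 1) * (r \<bullet> s) + (norm s)\<^sup>2)"
      by simp
    then show ?thesis
      by (simp add: power2_eq_square algebra_simps)
  qed
  have dual: "1 / (2 * \<mu> * \<rho>) * (norm (y' - \<eta>))\<^sup>2 - 1 / (2 * \<mu> * \<rho>) * (norm (y - \<eta>))\<^sup>2
      = t * ((y - \<eta>) \<bullet> s) + \<mu> * (\<rho> * t\<^sup>2) / 2 * (norm s)\<^sup>2"
  proof -
    have "y' - \<eta> = (y - \<eta>) + (\<mu> * (\<rho> * t)) *\<^sub>R s"
      by (simp add: y')
    then have "(norm (y' - \<eta>))\<^sup>2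
        = (norm (y - \<eta>))\<^sup>2 + 2 * (\<mu> * (\<rho> * t)) * ((y - \<eta>) \<bullet> s) + (\<mu> * (\<rho> * t))\<^sup>2 * (norm s)\<^sup>2"
      by (simp only: power2_norm_eq_inner)
        (simp add: inner_add_left inner_add_right inner_commute power2_eq_square)
    then show ?thesis
      using \<open>0 < \<mu>\<close> \<open>0 < \<rho>\<close> by (simp add: power2_eq_square field_simps)
  qed
  have "\<mu> * (\<rho> * t\<^sup>2 / 2 * (norm s)\<^sup>2) \<le> \<delta> * (\<rho> * t\<^sup>2 / 2 * (norm s)\<^sup>2)"
    using \<open>\<mu> \<le> \<delta>\<close> \<open>0 < \<rho>\<close> by (intro mult_right_mono) auto
  then have "\<mu> * (\<rho> * t\<^sup>2) / 2 * (norm s)\<^sup>2 \<le> t * (\<delta> * (\<rho> * t) / 2 * (norm s)\<^sup>2)"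
    by (simp add: power2_eq_square algebra_simps)
  moreover have "t * ((y + (\<rho> * t * (t - 1)) *\<^sub>R r) \<bullet> s)
      = t * (\<eta> \<bullet> s) + t * ((y - \<eta>) \<bullet> s) + t * (\<rho> * t * (t - 1) * (r \<bullet> s))"
    by (simp add: inner_add_left inner_diff_left algebra_simps)
  ultimately show ?thesis
    using lin pen dual by (simp only: distrib_left)
qed

text \<open>Here \<open>f k\<close> stands for \<open>\<Psi> (x k) - \<Psi> xstar\<close>. It is a real-valued parameter because
  \<open>\<Psi> (x 0)\<close> may be infinite, while its coefficient \<open>t\<^sub>0\<^sup>2 - t\<^sub>0\<close> is zero.\<close>

definition flag_energy ::
  "(real^'n \<Rightarrow> real^'m) \<Rightarrow> real^'m \<Rightarrow> real \<Rightarrow> real \<Rightarrow> real \<Rightarrow> real^'n^'n \<Rightarrow> real^'n \<Rightarrow> real^'m \<Rightarrow>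
   (nat \<Rightarrow> real) \<Rightarrow> (nat \<Rightarrow> real^'n) \<Rightarrow> (nat \<Rightarrow> real^'n) \<Rightarrow> (nat \<Rightarrow> real^'m) \<Rightarrow> nat \<Rightarrow> real" where
  "flag_energy A b \<sigma> \<rho> \<mu> P xstar \<eta> f x z y k =
     (let t = flag_t \<sigma> k; T = t\<^sup>2 - t; r = A (x k) - b in
        T * f k + (T * (\<eta> \<bullet> r) + \<rho> / 2 * T\<^sup>2 * (norm r)\<^sup>2 + 1 / (2 * \<mu> * \<rho>) * (norm (y k - \<eta>))\<^sup>2)
        + t\<^sup>2 / 2 * (norm_wrt P (xstar - z k))\<^sup>2)"

lemma flag_residual_average:
  fixes A :: "real^'n \<Rightarrow> real^'m"
  assumes "linear A" "t \<noteq> 0" "x' = (1 - 1 / t) *\<^sub>R u + (1 / t) *\<^sub>R v"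
  shows "t *\<^sub>R (A x' - b) = (t - 1) *\<^sub>R (A u - b) + (A v - b)"
proof -
  have "t *\<^sub>R x' = (t - 1) *\<^sub>R u + v"
    using assms(2,3) by (simp add: scaleR_add_right right_diff_distrib)
  then have "t *\<^sub>R A x' = (t - 1) *\<^sub>R A u + A v"
    using assms(1) by (metis linear_add linear_scale)
  then show ?thesis
    by (simp add: algebra_simps)
qed

text \<open>One iteration: \<open>t\<^sub>k\<close> times the nice-map inequality at \<open>xstar\<close>, combined with convexity
  along the averaging step and with \<open>dual_energy_increment\<close>.\<close>

lemma flag_energy_step:
  fixes A :: "real^'n \<Rightarrow> real^'m"
  assumes psi_proper: "proper \<Psi>" and conv: "strongly_convex \<sigma> \<Psi>" and lin: "linear A"
    and nice: "nice_primal_map \<Psi> A b \<sigma> \<rho> (flag_t \<sigma> k) \<delta> P Q (Prim (flag_t \<sigma> k))"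
    and \<mu>: "0 < \<mu>" "\<mu> \<le> \<delta>" and \<rho>: "\<rho> > 0" and \<sigma>: "\<sigma> > 0"
    and seq: "flag_sequence A b \<sigma> \<rho> \<mu> Prim x z y"
    and P: "loewner_le 0 P" "loewner_le P ((\<sigma> / 2) *\<^sub>R mat 1)"
    and feas: "A xstar = b" and p: "\<Psi> xstar = ereal p"
    and fin: "k = 0 \<or> \<Psi> (x k) = ereal (p + f k)"
  obtains w where "\<Psi> (x (Suc k)) = ereal (p + w)"
    and "f (Suc k) = w \<Longrightarrow> flag_energy A b \<sigma> \<rho> \<mu> P xstar \<eta> f x z y (Suc k)
           \<le> flag_energy A b \<sigma> \<rho> \<mu> P xstar \<eta> f x z y k"
proof -
  define t where "t = flag_t \<sigma> k"
  define t' where "t' = flag_t \<sigma> (Suc k)"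
  define r where "r = A (x k) - b"
  define r' where "r' = A (x (Suc k)) - b"
  define s where "s = A (z (Suc k)) - b"
  define a where "a = (norm_wrt P (xstar - z k))\<^sup>2"
  define a' where "a' = (norm_wrt P (xstar - z (Suc k)))\<^sup>2"
  define d where "d = (norm (xstar - z (Suc k)))\<^sup>2"
  define lam where "lam = y k + (\<rho> * t * (t - 1)) *\<^sub>R r"
  have t: "1 \<le> t" "t'\<^sup>2 - t' = t\<^sup>2" "t' \<le> 2 * t"
    using flag_t_ge_1 flag_t_Suc_square flag_t_Suc_le \<sigma> by (auto simp: t_def t'_def simp del: flag_t.simps)
  have zS: "z (Suc k) \<in> Prim t (z k, lam)"
    and yS: "y (Suc k) = y k + (\<mu> * (\<rho> * t)) *\<^sub>R s"
    and xS: "x (Suc k) = (1 - 1 / t) *\<^sub>R x k + (1 / t) *\<^sub>R z (Suc k)"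
    using seq \<sigma> unfolding flag_sequence_def Let_def
    by (auto simp: penalty_def t_def lam_def r_def s_def)
  obtain q where q: "\<Psi> (z (Suc k)) = ereal q"
    and prim: "q - p + lam \<bullet> s + \<rho> * t / 2 * (norm s)\<^sup>2
      \<le> t / 2 * (a - a') - \<sigma> / 2 * d - \<delta> * (\<rho> * t) / 2 * (norm s)\<^sup>2"
    using nice_primal_map_real[OF psi_proper nice[folded t_def] zS feas p \<sigma>] t
    unfolding s_def a_def a'_def d_def by auto
  have "t = 1 \<or> \<Psi> (x k) = ereal (p + f k)"
    using fin by (auto simp: t_def)
  then obtain w where w: "\<Psi> (x (Suc k)) = ereal w" and wle: "t * w \<le> (t - 1) * (p + f k) + q"
    unfolding xS by (rule strongly_convex_average[OF psi_proper conv less_imp_le[OF \<sigma>] t(1) q])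
  show ?thesis
  proof (rule that[of "w - p"])
    show "\<Psi> (x (Suc k)) = ereal (p + (w - p))"
      using w by simp
  next
    assume f: "f (Suc k) = w - p"
    have obj: "t\<^sup>2 * f (Suc k) - (t\<^sup>2 - t) * f k \<le> t * (q - p)"
    proof -
      have "t * (t * w) \<le> t * ((t - 1) * (p + f k) + q)"
        using t wle by (intro mult_left_mono) auto
      then show ?thesis
        by (simp add: f power2_eq_square algebra_simps)
    qed
    have dual: "t\<^sup>2 * (\<eta> \<bullet> r') + \<rho> / 2 * (t\<^sup>2)\<^sup>2 * (norm r')\<^sup>2
          + 1 / (2 * \<mu> * \<rho>) * (norm (y (Suc k) - \<eta>))\<^sup>2
        - ((t\<^sup>2 - t) * (\<eta> \<bullet> r) + \<rho> / 2 * (t\<^sup>2 - t)\<^sup>2 * (norm r)\<^sup>2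
          + 1 / (2 * \<mu> * \<rho>) * (norm (y k - \<eta>))\<^sup>2)
      \<le> t * (lam \<bullet> s + \<rho> * t / 2 * (norm s)\<^sup>2 + \<delta> * (\<rho> * t) / 2 * (norm s)\<^sup>2)"
      unfolding lam_def
    proof (rule dual_energy_increment)
      show "t *\<^sub>R r' = (t - 1) *\<^sub>R r + s"
        unfolding r'_def r_def s_def using flag_residual_average[OF lin _ xS] t by auto
    qed (use yS \<mu> \<rho> in auto)
    have "t * (q - p) + t * (lam \<bullet> s + \<rho> * t / 2 * (norm s)\<^sup>2 + \<delta> * (\<rho> * t) / 2 * (norm s)\<^sup>2)
        = t * (q - p + lam \<bullet> s + \<rho> * t / 2 * (norm s)\<^sup>2 + \<delta> * (\<rho> * t) / 2 * (norm s)\<^sup>2)"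
      by (simp add: algebra_simps)
    also have "\<dots> \<le> t * (t / 2 * (a - a') - \<sigma> / 2 * d)"
      using prim t by (intro mult_left_mono) auto
    \<comment> \<open>The growth of the weight is \<open>t'\<^sup>2 - t\<^sup>2 = t' \<le> 2 t\<close>, and \<open>a' \<le> (\<sigma> / 2) d\<close>.\<close>
    also have "\<dots> \<le> t\<^sup>2 / 2 * a - t'\<^sup>2 / 2 * a'"
    proof -
      have "t' * a' \<le> (2 * t) * (\<sigma> / 2 * d)"
        using norm_wrt_square_le[OF P] t \<sigma> unfolding a'_def d_def by (intro mult_mono) auto
      moreover have "t'\<^sup>2 * a' = t\<^sup>2 * a' + t' * a'"
        by (simp flip: t(2) add: algebra_simps)
      ultimately have le: "t'\<^sup>2 * a' / 2 \<le> (t\<^sup>2 * a' + (2 * t) * (\<sigma> / 2 * d)) / 2"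
        by simp
      have lhs: "t * (t / 2 * (a - a') - \<sigma> / 2 * d)
          = t\<^sup>2 / 2 * a - (t\<^sup>2 * a' + (2 * t) * (\<sigma> / 2 * d)) / 2"
        by (simp add: power2_eq_square field_simps)
      have rhs: "t\<^sup>2 / 2 * a - t'\<^sup>2 / 2 * a' = t\<^sup>2 / 2 * a - t'\<^sup>2 * a' / 2"
        by simp
      show ?thesis
        unfolding lhs rhs using le by (rule diff_left_mono)
    qed
    finally have "t\<^sup>2 * f (Suc k) + (t\<^sup>2 * (\<eta> \<bullet> r') + \<rho> / 2 * (t\<^sup>2)\<^sup>2 * (norm r')\<^sup>2
          + 1 / (2 * \<mu> * \<rho>) * (norm (y (Suc k) - \<eta>))\<^sup>2) + t'\<^sup>2 / 2 * a'
      \<le> (t\<^sup>2 - t) * f k + ((t\<^sup>2 - t) * (\<eta> \<bullet> r) + \<rho> / 2 * (t\<^sup>2 - t)\<^sup>2 * (norm r)\<^sup>2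
          + 1 / (2 * \<mu> * \<rho>) * (norm (y k - \<eta>))\<^sup>2) + t\<^sup>2 / 2 * a"
      using obj dual by linarith
    then show "flag_energy A b \<sigma> \<rho> \<mu> P xstar \<eta> f x z y (Suc k)
        \<le> flag_energy A b \<sigma> \<rho> \<mu> P xstar \<eta> f x z y k"
      unfolding flag_energy_def Let_def
      by (simp only: t_def[symmetric] t'_def[symmetric] r_def[symmetric] r'_def[symmetric]
          a_def[symmetric] a'_def[symmetric] t(2))
  qed
qed

section \<open>The convergence rate\<close>

text \<open>Telescoping, for an arbitrary multiplier \<open>\<eta>\<close>. That \<open>\<eta>\<close> is free is what later yields
  the objective and the residual bound at once.\<close>

lemma flag_lagrangian_gap:
  fixes A :: "real^'n \<Rightarrow> real^'m"
  assumes psi_proper: "proper \<Psi>" and conv: "strongly_convex \<sigma> \<Psi>" and lin: "linear A"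
    and nice: "\<And>k. nice_primal_map \<Psi> A b \<sigma> \<rho> (flag_t \<sigma> k) \<delta> P Q (Prim (flag_t \<sigma> k))"
    and \<mu>: "0 < \<mu>" "\<mu> \<le> \<delta>" and \<rho>: "\<rho> > 0" and \<sigma>: "\<sigma> > 0"
    and seq: "flag_sequence A b \<sigma> \<rho> \<mu> Prim x z y"
    and P: "loewner_le 0 P" "loewner_le P ((\<sigma> / 2) *\<^sub>R mat 1)"
    and feas: "A xstar = b" and p: "\<Psi> xstar = ereal p"
  obtains g where "\<Psi> (x (Suc n)) = ereal (p + g)"
    and "\<And>\<eta>. (flag_t \<sigma> n)\<^sup>2 * (g + \<eta> \<bullet> (A (x (Suc n)) - b))
           \<le> 1 / 2 * ((norm_wrt P (xstar - z 0))\<^sup>2 + 1 / (\<mu> * \<rho>) * (norm (y 0 - \<eta>))\<^sup>2)"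
proof -
  define f where "f = (\<lambda>k. real_of_ereal (\<Psi> (x k)) - p)"
  let ?E = "\<lambda>\<eta>. flag_energy A b \<sigma> \<rho> \<mu> P xstar \<eta> f x z y"
  have fin: "k = 0 \<or> \<Psi> (x k) = ereal (p + f k)" for k
  proof (induction k)
    case (Suc k)
    obtain w where "\<Psi> (x (Suc k)) = ereal (p + w)"
      by (rule flag_energy_step[where f = f,
            OF psi_proper conv lin nice \<mu> \<rho> \<sigma> seq P feas p Suc.IH])
    then show ?case
      by (simp add: f_def)
  qed simp
  have step: "?E \<eta> (Suc k) \<le> ?E \<eta> k" for \<eta> k
  proof -
    obtain w where "\<Psi> (x (Suc k)) = ereal (p + w)" "f (Suc k) = w \<Longrightarrow> ?E \<eta> (Suc k) \<le> ?E \<eta> k"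
      by (rule flag_energy_step[where f = f,
            OF psi_proper conv lin nice \<mu> \<rho> \<sigma> seq P feas p fin]) (rule that)
    then show ?thesis
      by (simp add: f_def)
  qed
  have dec: "?E \<eta> k \<le> ?E \<eta> 0" for \<eta> k
    using lift_Suc_antimono_le[of "?E \<eta>" 0 k] step by simp
  show ?thesis
  proof (rule that)
    show "\<Psi> (x (Suc n)) = ereal (p + f (Suc n))"
      using fin[of "Suc n"] by simp
  next
    fix \<eta>
    let ?t = "flag_t \<sigma> n" and ?r = "A (x (Suc n)) - b"
    have "?t\<^sup>2 * (f (Suc n) + \<eta> \<bullet> ?r) \<le> ?E \<eta> (Suc n)"
    proof -
      have "0 \<le> \<rho> / 2 * (?t\<^sup>2)\<^sup>2 * (norm ?r)\<^sup>2"
        "0 \<le> 1 / (2 * \<mu> * \<rho>) * (norm (y (Suc n) - \<eta>))\<^sup>2"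
        "0 \<le> (flag_t \<sigma> (Suc n))\<^sup>2 / 2 * (norm_wrt P (xstar - z (Suc n)))\<^sup>2"
        using \<mu> \<rho> by auto
      moreover have T: "(flag_t \<sigma> (Suc n))\<^sup>2 - flag_t \<sigma> (Suc n) = ?t\<^sup>2"
        using flag_t_Suc_square \<sigma> by simp
      ultimately show ?thesis
        unfolding flag_energy_def Let_def T distrib_left by linarith
    qed
    also have "\<dots> \<le> ?E \<eta> 0"
      by (rule dec)
    also have "\<dots> = 1 / 2 * ((norm_wrt P (xstar - z 0))\<^sup>2 + 1 / (\<mu> * \<rho>) * (norm (y 0 - \<eta>))\<^sup>2)"
      by (simp add: flag_energy_def Let_def field_simps)
    finally show "?t\<^sup>2 * (f (Suc n) + \<eta> \<bullet> ?r)
        \<le> 1 / 2 * ((norm_wrt P (xstar - z 0))\<^sup>2 + 1 / (\<mu> * \<rho>) * (norm (y 0 - \<eta>))\<^sup>2)" .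
  qed
qed

lemma exists_aligned_vector:
  fixes r :: "'a::real_inner"
  assumes "c \<ge> 0"
  obtains \<eta> where "norm \<eta> \<le> c" "\<eta> \<bullet> r = c * norm r"
proof -
  have "norm (c *\<^sub>R sgn r) \<le> c" "(c *\<^sub>R sgn r) \<bullet> r = c * norm r"
    using assms
    by (simp_all add: norm_sgn sgn_div_norm dot_square_norm power2_eq_square field_simps)
  then show ?thesis
    using that by blast
qed

theorem theorem4p1:
  fixes \<Psi> :: "real^'n \<Rightarrow> ereal"
    and A :: "real^'n \<Rightarrow> real^'m"
    and b :: "real^'m"
    and \<sigma> \<rho> \<mu> \<delta> c :: real
    and P Q :: "real^'n^'n"
    and Prim :: "real \<Rightarrow> (real^'n) \<times> (real^'m) \<Rightarrow> (real^'n) set"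
    and x z :: "nat \<Rightarrow> real^'n"
    and y :: "nat \<Rightarrow> real^'m"
    and ystar :: "real^'m"
  assumes "proper \<Psi>" and "lower_semicontinuous \<Psi>" and "strongly_convex \<sigma> \<Psi>"
    and "linear A"
    and "\<exists>xs ys. saddle_point \<Psi> A b xs ys"
    and "dual_optimal \<Psi> A b ystar" and "c > 0" and "c \<ge> 2 * norm ystar"
    and "\<And>k. nice_primal_map \<Psi> A b \<sigma> \<rho> (flag_t \<sigma> k) \<delta> P Q (Prim (flag_t \<sigma> k))"
    and "0 < \<mu>" and "\<mu> \<le> \<delta>" and "\<rho> > 0"
    and "flag_sequence A b \<sigma> \<rho> \<mu> Prim x z y"
    and "\<sigma> > 0"
    and "loewner_le 0 P" and "loewner_le P ((\<sigma> / 2) *\<^sub>R mat 1)"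
  shows "\<forall>xstar N. primal_optimal \<Psi> A b xstar \<and> 1 \<le> N \<longrightarrow>
           \<Psi> (x N) - \<Psi> xstar \<le> ereal (B_const P \<mu> \<rho> c (z 0) (y 0) xstar / (2 * (real N)\<^sup>2)) \<and>
           norm (A (x N) - b) \<le> B_const P \<mu> \<rho> c (z 0) (y 0) xstar / (c * (real N)\<^sup>2)"
proof (intro allI impI)
  fix xstar and N :: nat
  assume "primal_optimal \<Psi> A b xstar \<and> 1 \<le> N"
  then have opt: "primal_optimal \<Psi> A b xstar" and "1 \<le> N" by auto
  then obtain n where N: "N = Suc n"
    by (cases N) auto
  obtain xs ys where sad: "saddle_point \<Psi> A b xs ys"
    using assms(5) by blast
  have feas: "A xstar = b"
    using opt by (simp add: primal_optimal_def feasible_set_def)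
  obtain p where p: "\<Psi> xstar = ereal p"
    using primal_optimal_finite[OF assms(1) sad opt] .
  let ?r = "A (x N) - b" and ?B = "B_const P \<mu> \<rho> c (z 0) (y 0) xstar"
  obtain g where "\<Psi> (x (Suc n)) = ereal (p + g)"
    and "\<And>\<eta>. (flag_t \<sigma> n)\<^sup>2 * (g + \<eta> \<bullet> (A (x (Suc n)) - b))
           \<le> 1 / 2 * ((norm_wrt P (xstar - z 0))\<^sup>2 + 1 / (\<mu> * \<rho>) * (norm (y 0 - \<eta>))\<^sup>2)"
    by (rule flag_lagrangian_gap[OF assms(1,3,4,9-12,14,13,15,16) feas p, of n]) (rule that)
  note g = this(1)[folded N] and gap = this(2)[folded N]
  obtain \<eta> where \<eta>: "norm \<eta> \<le> c" "\<eta> \<bullet> ?r = c * norm ?r"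
    using exists_aligned_vector[of c ?r] assms(7) by auto
  have lower: "- (c / 2 * norm ?r) \<le> g"
  proof -
    have "ereal p \<le> ereal (p + g) + ereal (ystar \<bullet> ?r)"
      using dual_optimal_lower_bound[OF assms(1) sad assms(6) opt, of "x N"] by (simp add: p g)
    then have "- (ystar \<bullet> ?r) \<le> g"
      by simp
    moreover have "ystar \<bullet> ?r \<le> norm ystar * norm ?r"
      by (rule norm_cauchy_schwarz)
    moreover have "norm ystar * norm ?r \<le> c / 2 * norm ?r"
      using assms(8) by (intro mult_right_mono) auto
    ultimately show ?thesis
      by linarith
  qed
  have upper: "g + c * norm ?r \<le> ?B / (2 * (real N)\<^sup>2)"
  proof -
    let ?G = "g + c * norm ?r"
    have "0 \<le> c / 2 * norm ?r"
      using assms(7) by simp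
    then have G: "0 \<le> ?G"
      using lower by linarith
    have "(real N / 2)\<^sup>2 \<le> (flag_t \<sigma> n)\<^sup>2"
      using flag_t_ge[of \<sigma> n] assms(14) by (intro power_mono) (auto simp: N)
    then have "(real N / 2)\<^sup>2 * ?G \<le> (flag_t \<sigma> n)\<^sup>2 * ?G"
      using G by (rule mult_right_mono)
    also have "\<dots> \<le> 1 / 2 * ((norm_wrt P (xstar - z 0))\<^sup>2 + 1 / (\<mu> * \<rho>) * (norm (y 0 - \<eta>))\<^sup>2)"
      using gap[of \<eta>] \<eta>(2) by simp
    also have "\<dots> \<le> ?B / 8"
    proof -
      have "norm (y 0 - \<eta>) \<le> norm (y 0) + c"
        using norm_triangle_ineq4[of "y 0" \<eta>] \<eta>(1) by linarith
      then have "1 / 2 * ((norm_wrt P (xstar - z 0))\<^sup>2 + 1 / (\<mu> * \<rho>) * (norm (y 0 - \<eta>))\<^sup>2)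
          \<le> 1 / 2 * ((norm_wrt P (xstar - z 0))\<^sup>2 + 1 / (\<mu> * \<rho>) * (norm (y 0) + c)\<^sup>2)"
        using assms(10,12) by (intro mult_left_mono add_left_mono power_mono) auto
      also have "\<dots> = ?B / 8"
        by (simp add: B_const_def)
      finally show ?thesis .
    qed
    finally show ?thesis
      by (simp add: N field_simps)
  qed
  have "\<Psi> (x N) - \<Psi> xstar \<le> ereal (?B / (2 * (real N)\<^sup>2))"
  proof -
    have "0 \<le> c * norm ?r"
      using assms(7) by simp
    then show ?thesis
      using upper by (simp add: p g)
  qed
  moreover have "norm ?r \<le> ?B / (c * (real N)\<^sup>2)"
  proof -
    have "c / 2 * norm ?r \<le> ?B / (2 * (real N)\<^sup>2)"
      using lower upper by linarith
    then show ?thesis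
      using assms(7) by (simp add: N field_simps)
  qed
  ultimately show "\<Psi> (x N) - \<Psi> xstar \<le> ereal (?B / (2 * (real N)\<^sup>2)) \<and>
      norm ?r \<le> ?B / (c * (real N)\<^sup>2)" ..
qed

end
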